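(* Let $(\Omega,\mathrm{pr})$ be a probability scheme and let $\mathcal{A}$ be a unital $\mathbb{R}$-subalgebra of $\mathbb{R}^{\Omega}$. Then: (i) $\mathrm{E}_{\mathcal{A}}$ is $\mathcal{A}$-linear, and its restriction to $\mathcal{A}$ is the identity map. (ii) $\mathrm{E}_{\mathcal{B}}\mathrm{E}_{\mathcal{A}}=\mathrm{E}_{\mathcal{B}}$ for every unital $\mathbb{R}$-subalgebra $\mathcal{B}$ of $\mathcal{A}$. (iii) $\mathrm{E}'_{\mathcal{A}}\mathrm{E}_{\mathcal{A}}=\mathrm{E}$, where $\mathrm{E}'_{\mathcal{A}}$ is the expectation on the scheme $\Omega_{\mathcal{A}}$ of atoms of $\mathcal{A}$, and elements of $\mathcal{A}$ are identified with functions on $\Omega_{\mathcal{A}}$ (an element of $\mathcal{A}$ being identified with the function sending an atom $A$ to its constant value on $A$).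
   Context: A (probability) scheme is a finite set $\Omega$ with a function $\mathrm{pr}\colon\Omega\to(0,\infty)$ such that $\sum_{\omega}\mathrm{pr}(\omega)=1$. $\mathbb{R}^{\Omega}$ is the real algebra of functions $\Omega\to\mathbb{R}$ under pointwise operations, and $\mathrm{E}X=\sum_{\omega}X(\omega)\mathrm{pr}(\omega)$. For a unital $\mathbb{R}$-subalgebra $\mathcal{A}\subseteq\mathbb{R}^{\Omega}$, the atoms of $\mathcal{A}$ are the equivalence classes of the relation $\omega_1\equiv_{\mathcal{A}}\omega_2\iff X(\omega_1)=X(\omega_2)$ for all $X\in\mathcal{A}$. $\Omega_{\mathcal{A}}$ is the scheme whose points are the atoms of $\mathcal{A}$, an atom $A$ having probability $\Pr(A)=\sum_{\omega\in A}\mathrm{pr}(\omega)$. The conditional expectation relative to $\mathcal{A}$ is the operator on $\mathbb{R}^{\Omega}$ given by $\mathrm{E}_{\mathcal{A}}X=\sum_{A}\mathrm{E}(X|A)1_A$, the sum over atoms $A$ of $\mathcal{A}$, where $1_A$ is the indicator function of $A$ and $\mathrm{E}(X|A)=\frac{1}{\Pr(A)}\sum_{\omega\in A}X(\omega)\mathrm{pr}(\omega)$. *)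

theory Defs
  imports Complex_Main "HOL-Library.FuncSet" "HOL-Library.Indicator_Function"
begin

locale prob_scheme =
  fixes \<Omega> :: "'a set" and pr :: "'a \<Rightarrow> real"
  assumes finite_points: "finite \<Omega>"
    and pr_pos: "\<And>\<omega>. \<omega> \<in> \<Omega> \<Longrightarrow> 0 < pr \<omega>"
    and pr_sum: "(\<Sum>\<omega>\<in>\<Omega>. pr \<omega>) = 1"

text \<open>A function on \<open>\<Omega>\<close> is represented by its extensional representative (equal to
  \<open>undefined\<close> off \<open>\<Omega>\<close>), so that HOL equality is equality of functions on \<open>\<Omega>\<close>.\<close>

definition real_functions :: "'a set \<Rightarrow> ('a \<Rightarrow> real) set" where
  "real_functions \<Omega> = \<Omega> \<rightarrow>\<^sub>E UNIV"

definition unital_subalgebra :: "'a set \<Rightarrow> ('a \<Rightarrow> real) set \<Rightarrow> bool" where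
  "unital_subalgebra \<Omega> \<A> \<longleftrightarrow>
     \<A> \<subseteq> real_functions \<Omega> \<and>
     (\<lambda>\<omega>\<in>\<Omega>. 1) \<in> \<A> \<and>
     (\<forall>X\<in>\<A>. \<forall>Y\<in>\<A>. (\<lambda>\<omega>\<in>\<Omega>. X \<omega> + Y \<omega>) \<in> \<A>) \<and>
     (\<forall>X\<in>\<A>. \<forall>Y\<in>\<A>. (\<lambda>\<omega>\<in>\<Omega>. X \<omega> * Y \<omega>) \<in> \<A>) \<and>
     (\<forall>c. \<forall>X\<in>\<A>. (\<lambda>\<omega>\<in>\<Omega>. c * X \<omega>) \<in> \<A>)"

definition indist :: "'a set \<Rightarrow> ('a \<Rightarrow> real) set \<Rightarrow> ('a \<times> 'a) set" where
  "indist \<Omega> \<A> = {(\<omega>1, \<omega>2) \<in> \<Omega> \<times> \<Omega>. \<forall>X\<in>\<A>. X \<omega>1 = X \<omega>2}"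

definition atoms :: "'a set \<Rightarrow> ('a \<Rightarrow> real) set \<Rightarrow> 'a set set" where
  "atoms \<Omega> \<A> = \<Omega> // indist \<Omega> \<A>"

definition expectation :: "'a set \<Rightarrow> ('a \<Rightarrow> real) \<Rightarrow> ('a \<Rightarrow> real) \<Rightarrow> real" where
  "expectation \<Omega> pr X = (\<Sum>\<omega>\<in>\<Omega>. X \<omega> * pr \<omega>)"

definition event_prob :: "('a \<Rightarrow> real) \<Rightarrow> 'a set \<Rightarrow> real" where
  "event_prob pr A = (\<Sum>\<omega>\<in>A. pr \<omega>)"

definition expectation_given :: "('a \<Rightarrow> real) \<Rightarrow> ('a \<Rightarrow> real) \<Rightarrow> 'a set \<Rightarrow> real" where
  "expectation_given pr X A = 1 / event_prob pr A * (\<Sum>\<omega>\<in>A. X \<omega> * pr \<omega>)"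

definition cond_expectation ::
  "'a set \<Rightarrow> ('a \<Rightarrow> real) \<Rightarrow> ('a \<Rightarrow> real) set \<Rightarrow> ('a \<Rightarrow> real) \<Rightarrow> 'a \<Rightarrow> real" where
  "cond_expectation \<Omega> pr \<A> X =
     (\<lambda>\<omega>\<in>\<Omega>. \<Sum>A\<in>atoms \<Omega> \<A>. expectation_given pr X A * indicator A \<omega>)"

text \<open>Module endomorphisms of the algebra of all functions on \<open>\<Omega>\<close> over a subalgebra \<open>\<A>\<close>.
  Real homogeneity is the case where \<open>Y\<close> is a constant function.\<close>

definition linear_over ::
  "'a set \<Rightarrow> ('a \<Rightarrow> real) set \<Rightarrow> (('a \<Rightarrow> real) \<Rightarrow> ('a \<Rightarrow> real)) \<Rightarrow> bool" where
  "linear_over \<Omega> \<A> T \<longleftrightarrow>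
     T \<in> real_functions \<Omega> \<rightarrow> real_functions \<Omega> \<and>
     (\<forall>X\<in>real_functions \<Omega>. \<forall>X'\<in>real_functions \<Omega>.
        T (\<lambda>\<omega>\<in>\<Omega>. X \<omega> + X' \<omega>) = (\<lambda>\<omega>\<in>\<Omega>. T X \<omega> + T X' \<omega>)) \<and>
     (\<forall>Y\<in>\<A>. \<forall>X\<in>real_functions \<Omega>.
        T (\<lambda>\<omega>\<in>\<Omega>. Y \<omega> * X \<omega>) = (\<lambda>\<omega>\<in>\<Omega>. Y \<omega> * T X \<omega>))"

text \<open>The function on atoms with which an element \<open>Y\<close> of \<open>\<A>\<close> is identified; meaningful only
  when \<open>Y\<close> is constant on each atom.\<close>

definition on_atoms ::
  "'a set \<Rightarrow> ('a \<Rightarrow> real) set \<Rightarrow> ('a \<Rightarrow> real) \<Rightarrow> 'a set \<Rightarrow> real" where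
  "on_atoms \<Omega> \<A> Y = (\<lambda>A\<in>atoms \<Omega> \<A>. THE c. \<forall>\<omega>\<in>A. Y \<omega> = c)"

lemma equiv_indist: "equiv \<Omega> (indist \<Omega> \<A>)"
  by (rule equivI) (auto simp: indist_def refl_on_def sym_def trans_def)

lemma on_atoms_eq:
  assumes "Y \<in> \<A>" "A \<in> atoms \<Omega> \<A>" "\<omega> \<in> A"
  shows "on_atoms \<Omega> \<A> Y A = Y \<omega>"
proof -
  have "Y \<omega>' = Y \<omega>" if "\<omega>' \<in> A" for \<omega>'
  proof -
    have "(\<omega>', \<omega>) \<in> indist \<Omega> \<A>"
      using quotient_eq_iff[OF equiv_indist, of A \<Omega> \<A> A \<omega>' \<omega>] assms(2,3) that
      by (simp add: atoms_def)
    then show ?thesis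
      using assms(1) by (simp add: indist_def)
  qed
  then have "(THE c. \<forall>\<omega>'\<in>A. Y \<omega>' = c) = Y \<omega>"
    using assms(3) by (intro the_equality; metis)
  then show ?thesis
    using assms(2) by (simp add: on_atoms_def)
qed

lemma prob_scheme_atoms:
  assumes "prob_scheme \<Omega> pr"
  shows "prob_scheme (atoms \<Omega> \<A>) (event_prob pr)"
proof -
  interpret prob_scheme \<Omega> pr by fact
  note eq = equiv_indist[of \<Omega> \<A>]
  have sub: "A \<subseteq> \<Omega>" if "A \<in> atoms \<Omega> \<A>" for A
    using in_quotient_imp_subset[OF eq] that by (simp add: atoms_def)
  have un: "\<Union>(atoms \<Omega> \<A>) = \<Omega>"
    using eq unfolding atoms_def by (rule Union_quotient)
  show ?thesis
  proof
    show "finite (atoms \<Omega> \<A>)"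
      by (rule finite_UnionD) (simp add: un finite_points)
  next
    fix A assume A: "A \<in> atoms \<Omega> \<A>"
    then have "A \<noteq> {}"
      using in_quotient_imp_non_empty[OF eq] by (simp add: atoms_def)
    then show "0 < event_prob pr A"
      unfolding event_prob_def using sub[OF A] pr_pos finite_points
      by (intro sum_pos) (auto intro: finite_subset)
  next
    have "(\<Sum>A\<in>atoms \<Omega> \<A>. event_prob pr A) = (\<Sum>\<omega>\<in>\<Union>(atoms \<Omega> \<A>). pr \<omega>)"
      unfolding event_prob_def
    proof (subst sum.Union_disjoint)
      show "\<forall>A\<in>atoms \<Omega> \<A>. finite A"
        by (auto intro: finite_subset[OF sub finite_points])
      show "\<forall>A\<in>atoms \<Omega> \<A>. \<forall>B\<in>atoms \<Omega> \<A>. A \<noteq> B \<longrightarrow> A \<inter> B = {}"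
      proof (intro ballI impI)
        fix A B assume "A \<in> atoms \<Omega> \<A>" "B \<in> atoms \<Omega> \<A>" "A \<noteq> B"
        then show "A \<inter> B = {}"
          using quotient_disj[OF eq, of A B] by (simp add: atoms_def)
      qed
    qed simp
    then show "(\<Sum>A\<in>atoms \<Omega> \<A>. event_prob pr A) = 1"
      by (simp add: un pr_sum)
  qed
qed

end

theory Submission
  imports Defs
begin

text \<open>If \<open>\<omega>\<^sub>0\<close> lies in the atom \<open>A\<close>, then each \<open>\<omega> \<notin> A\<close> is separated from \<open>\<omega>\<^sub>0\<close> by some \<open>X \<in> \<A>\<close>,
  and \<open>(X - X \<omega>) / (X \<omega>\<^sub>0 - X \<omega>)\<close> takes the values 1 at \<open>\<omega>\<^sub>0\<close> and 0 at \<open>\<omega>\<close>. The product of these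
  functions over all \<open>\<omega> \<notin> A\<close> is \<open>1\<^sub>A\<close>. Hence \<open>\<A>\<close> contains the indicators of its atoms, and so all
  conditional expectations relative to \<open>\<A>\<close>. The rest follows by averaging: the operator preserves
  the weighted sum over each atom of \<open>\<A>\<close>, so \<open>E (Z \<cdot> E\<^sub>\<A> X) = E (Z \<cdot> X)\<close> for \<open>Z \<in> \<A>\<close>; taking for
  \<open>Z\<close> the indicator of an atom of \<open>\<B>\<close> gives (ii), and taking \<open>Z = 1\<close> gives (iii).\<close>

section \<open>Atoms as a finite partition of the scheme\<close>

lemma atoms_memD:
  assumes "A \<in> atoms \<Omega> \<A>"
  shows "A \<subseteq> \<Omega>" "A \<noteq> {}"
  using assms in_quotient_imp_subset[OF equiv_indist] in_quotient_imp_non_empty[OF equiv_indist]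
  unfolding atoms_def by blast+

lemma atoms_eqI:
  assumes "A \<in> atoms \<Omega> \<A>" "B \<in> atoms \<Omega> \<A>" "\<omega> \<in> A" "\<omega> \<in> B"
  shows "A = B"
  using assms quotient_disj[OF equiv_indist, of A \<Omega> \<A> B] unfolding atoms_def by blast

lemma Union_atoms: "\<Union>(atoms \<Omega> \<A>) = \<Omega>"
  unfolding atoms_def by (rule Union_quotient[OF equiv_indist])

lemma atom_containing:
  assumes "\<omega> \<in> \<Omega>"
  obtains A where "A \<in> atoms \<Omega> \<A>" "\<omega> \<in> A"
  using assms Union_atoms[of \<Omega> \<A>] by blast

lemma finite_atoms: "finite \<Omega> \<Longrightarrow> finite (atoms \<Omega> \<A>)"
  by (rule finite_UnionD) (simp add: Union_atoms)

lemma constant_on_atom: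
  assumes "Y \<in> \<A>" "A \<in> atoms \<Omega> \<A>" "\<omega> \<in> A" "\<omega>' \<in> A"
  shows "Y \<omega> = Y \<omega>'"
  using on_atoms_eq[OF assms(1,2,3)] on_atoms_eq[OF assms(1,2,4)] by simp

lemma separated_from_atom:
  assumes "A \<in> atoms \<Omega> \<A>" "\<omega>0 \<in> A" "\<omega> \<in> \<Omega> - A"
  obtains X where "X \<in> \<A>" "X \<omega>0 \<noteq> X \<omega>"
proof -
  have \<omega>: "\<omega> \<in> \<Omega>" "\<omega> \<notin> A"
    using assms(3) by simp_all
  obtain B where B: "B \<in> atoms \<Omega> \<A>" "\<omega> \<in> B"
    using \<omega>(1) by (rule atom_containing)
  \<comment> \<open>Equivalence of the two points would force \<open>A = B\<close>, although
    \<open>\<omega>\<close> lies in \<open>B\<close> and not in \<open>A\<close>.\<close>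
  have "(\<omega>0, \<omega>) \<notin> indist \<Omega> \<A>"
    using quotient_eq_iff[OF equiv_indist, of A \<Omega> \<A> B \<omega>0 \<omega>] assms(1,2) \<omega> B
    by (simp add: atoms_def, blast)
  then show thesis
    using that assms atoms_memD(1)[OF assms(1)] by (auto simp: indist_def)
qed

lemma sum_over_atoms:
  assumes "finite \<Omega>"
  shows "(\<Sum>A\<in>atoms \<Omega> \<A>. \<Sum>\<omega>\<in>A. f \<omega>) = (\<Sum>\<omega>\<in>\<Omega>. f \<omega>)"
proof -
  have "(\<Sum>\<omega>\<in>\<Union>(atoms \<Omega> \<A>). f \<omega>) = (\<Sum>A\<in>atoms \<Omega> \<A>. \<Sum>\<omega>\<in>A. f \<omega>)"
  proof (subst sum.Union_disjoint)
    show "\<forall>A\<in>atoms \<Omega> \<A>. finite A"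
      using atoms_memD(1) assms finite_subset by metis
    show "\<forall>A\<in>atoms \<Omega> \<A>. \<forall>B\<in>atoms \<Omega> \<A>. A \<noteq> B \<longrightarrow> A \<inter> B = {}"
      by (meson atoms_eqI disjoint_iff)
  qed simp
  then show ?thesis
    by (simp add: Union_atoms)
qed

section \<open>Closure properties of unital subalgebras\<close>

lemma unital_subalgebraD:
  assumes "unital_subalgebra \<Omega> \<A>"
  shows "(\<lambda>\<omega>\<in>\<Omega>. c) \<in> \<A>"
    and "X \<in> \<A> \<Longrightarrow> Y \<in> \<A> \<Longrightarrow> (\<lambda>\<omega>\<in>\<Omega>. X \<omega> + Y \<omega>) \<in> \<A>"
    and "X \<in> \<A> \<Longrightarrow> Y \<in> \<A> \<Longrightarrow> (\<lambda>\<omega>\<in>\<Omega>. X \<omega> * Y \<omega>) \<in> \<A>"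
    and "X \<in> \<A> \<Longrightarrow> (\<lambda>\<omega>\<in>\<Omega>. c * X \<omega>) \<in> \<A>"
    and "X \<in> \<A> \<Longrightarrow> X \<in> extensional \<Omega>"
proof -
  have one: "(\<lambda>\<omega>\<in>\<Omega>. 1) \<in> \<A>"
    and scale: "\<And>c X. X \<in> \<A> \<Longrightarrow> (\<lambda>\<omega>\<in>\<Omega>. c * X \<omega>) \<in> \<A>"
    using assms unfolding unital_subalgebra_def by blast+
  \<comment> \<open>Constants are the scalar multiples of the unit.\<close>
  have "(\<lambda>\<omega>\<in>\<Omega>. c * (\<lambda>\<omega>\<in>\<Omega>. 1) \<omega>) = (\<lambda>\<omega>\<in>\<Omega>. c)"
    by auto
  then show "(\<lambda>\<omega>\<in>\<Omega>. c) \<in> \<A>"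
    using scale[OF one, of c] by simp
qed (use assms in \<open>auto simp: unital_subalgebra_def real_functions_def PiE_def\<close>)

text \<open>Induction on \<open>I\<close>; the empty product is the unit, which covers the case of a
  single atom equal to \<open>\<Omega>\<close>.\<close>

lemma unital_subalgebra_prod:
  assumes "unital_subalgebra \<Omega> \<A>" "finite I" "\<And>i. i \<in> I \<Longrightarrow> F i \<in> \<A>"
  shows "(\<lambda>\<omega>\<in>\<Omega>. \<Prod>i\<in>I. F i \<omega>) \<in> \<A>"
  using assms(2,3)
proof (induction I rule: finite_induct)
  case (insert i I)
  then have "(\<lambda>\<omega>\<in>\<Omega>. F i \<omega> * (\<lambda>\<omega>\<in>\<Omega>. \<Prod>i\<in>I. F i \<omega>) \<omega>) \<in> \<A>"
    by (intro unital_subalgebraD(3)[OF assms(1)]) auto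
  also have "(\<lambda>\<omega>\<in>\<Omega>. F i \<omega> * (\<lambda>\<omega>\<in>\<Omega>. \<Prod>i\<in>I. F i \<omega>) \<omega>) = (\<lambda>\<omega>\<in>\<Omega>. \<Prod>i\<in>insert i I. F i \<omega>)"
    using insert.hyps by (auto simp: fun_eq_iff)
  finally show ?case .
qed (simp add: unital_subalgebraD(1)[OF assms(1)])

lemma unital_subalgebra_sum:
  assumes "unital_subalgebra \<Omega> \<A>" "finite I" "\<And>i. i \<in> I \<Longrightarrow> F i \<in> \<A>"
  shows "(\<lambda>\<omega>\<in>\<Omega>. \<Sum>i\<in>I. F i \<omega>) \<in> \<A>"
  using assms(2,3)
proof (induction I rule: finite_induct)
  case (insert i I)
  then have "(\<lambda>\<omega>\<in>\<Omega>. F i \<omega> + (\<lambda>\<omega>\<in>\<Omega>. \<Sum>i\<in>I. F i \<omega>) \<omega>) \<in> \<A>"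
    by (intro unital_subalgebraD(2)[OF assms(1)]) auto
  also have "(\<lambda>\<omega>\<in>\<Omega>. F i \<omega> + (\<lambda>\<omega>\<in>\<Omega>. \<Sum>i\<in>I. F i \<omega>) \<omega>) = (\<lambda>\<omega>\<in>\<Omega>. \<Sum>i\<in>insert i I. F i \<omega>)"
    using insert.hyps by (auto simp: fun_eq_iff)
  finally show ?case .
qed (simp add: unital_subalgebraD(1)[OF assms(1)])

section \<open>Indicators of atoms and conditional expectations lie in the algebra\<close>

lemma separating_element:
  assumes alg: "unital_subalgebra \<Omega> \<A>" and "X \<in> \<A>" "X \<omega>0 \<noteq> X \<omega>" "\<omega>0 \<in> \<Omega>" "\<omega> \<in> \<Omega>"
  obtains Y where "Y \<in> \<A>" "Y \<omega>0 = 1" "Y \<omega> = 0"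
proof
  \<comment> \<open>The difference \<open>X - X \<omega>\<close> is written as a sum with a constant
    function so that the closure rules apply literally.\<close>
  let ?Z = "\<lambda>\<tau>\<in>\<Omega>. X \<tau> + (\<lambda>\<tau>\<in>\<Omega>. - X \<omega>) \<tau>"
  let ?Y = "\<lambda>\<tau>\<in>\<Omega>. 1 / (X \<omega>0 - X \<omega>) * ?Z \<tau>"
  show "?Y \<in> \<A>"
    by (intro unital_subalgebraD(1,2,4)[OF alg] assms)
  show "?Y \<omega>0 = 1" "?Y \<omega> = 0"
    using assms by auto
qed

lemma indicator_atom_mem:
  assumes "finite \<Omega>" and alg: "unital_subalgebra \<Omega> \<A>" and A: "A \<in> atoms \<Omega> \<A>"
  shows "(\<lambda>\<omega>\<in>\<Omega>. indicator A \<omega>) \<in> \<A>"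
proof -
  obtain \<omega>0 where \<omega>0: "\<omega>0 \<in> A" "\<omega>0 \<in> \<Omega>"
    using atoms_memD[OF A] by blast
  have "\<exists>Y\<in>\<A>. Y \<omega>0 = 1 \<and> Y \<omega> = 0" if "\<omega> \<in> \<Omega> - A" for \<omega>
    using separated_from_atom[OF A \<omega>0(1) that] separating_element[OF alg] \<omega>0(2) that
    by (metis DiffD1)
  then obtain F where F: "\<And>\<omega>. \<omega> \<in> \<Omega> - A \<Longrightarrow> F \<omega> \<in> \<A>"
      "\<And>\<omega>. \<omega> \<in> \<Omega> - A \<Longrightarrow> F \<omega> \<omega>0 = 1" "\<And>\<omega>. \<omega> \<in> \<Omega> - A \<Longrightarrow> F \<omega> \<omega> = 0"
    by metis
  let ?P = "\<lambda>\<tau>\<in>\<Omega>. \<Prod>\<omega>\<in>\<Omega> - A. F \<omega> \<tau>"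
  have P: "?P \<in> \<A>"
    using assms(1) F(1) by (intro unital_subalgebra_prod[OF alg]) auto
  have "?P \<tau> = (\<lambda>\<omega>\<in>\<Omega>. indicator A \<omega>) \<tau>" for \<tau>
  proof -
    consider "\<tau> \<in> A" | "\<tau> \<in> \<Omega> - A" | "\<tau> \<notin> \<Omega>"
      by blast
    then show ?thesis
    proof cases
      case 1
      \<comment> \<open>The factors are normalised at \<open>\<omega>0\<close> only; membership of
        the product in \<open>\<A>\<close> carries the value 1 to the whole atom.\<close>
      have "?P \<tau> = ?P \<omega>0"
        using constant_on_atom[OF P A 1 \<omega>0(1)] .
      also have "\<dots> = 1"
        using \<omega>0(2) F(2) by simp
      finally show ?thesis
        using 1 atoms_memD(1)[OF A] by auto
    next
      case 2
      \<comment> \<open>The factor with index \<open>\<tau>\<close> vanishes at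
        \<open>\<tau>\<close>.\<close>
      then have "(\<Prod>\<omega>\<in>\<Omega> - A. F \<omega> \<tau>) = 0"
        using assms(1) F(3) by (intro prod_zero) auto
      then show ?thesis
        using 2 by simp
    qed simp
  qed
  then have "?P = (\<lambda>\<omega>\<in>\<Omega>. indicator A \<omega>)"
    by blast
  with P show ?thesis
    by simp
qed

text \<open>By definition this is a finite linear combination of indicators of atoms. In part (iii)
  it is what makes the identification with a function on atoms legitimate.\<close>

lemma cond_expectation_mem:
  assumes "finite \<Omega>" and alg: "unital_subalgebra \<Omega> \<A>"
  shows "cond_expectation \<Omega> pr \<A> X \<in> \<A>"
proof -
  let ?F = "\<lambda>A. \<lambda>\<omega>\<in>\<Omega>. expectation_given pr X A * (\<lambda>\<omega>\<in>\<Omega>. indicator A \<omega>) \<omega>"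
  have "(\<lambda>\<omega>\<in>\<Omega>. \<Sum>A\<in>atoms \<Omega> \<A>. ?F A \<omega>) \<in> \<A>"
    using assms by (intro unital_subalgebra_sum unital_subalgebraD(4) indicator_atom_mem
        finite_atoms)
  also have "(\<lambda>\<omega>\<in>\<Omega>. \<Sum>A\<in>atoms \<Omega> \<A>. ?F A \<omega>) = cond_expectation \<Omega> pr \<A> X"
    by (auto simp: cond_expectation_def fun_eq_iff)
  finally show ?thesis .
qed

text \<open>Atoms are disjoint, so only the summand of the atom containing \<open>\<omega>\<close>
  survives.\<close>

lemma cond_expectation_on_atom:
  assumes "finite \<Omega>" and A: "A \<in> atoms \<Omega> \<A>" "\<omega> \<in> A"
  shows "cond_expectation \<Omega> pr \<A> X \<omega> = expectation_given pr X A"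
proof -
  have "(\<Sum>B\<in>atoms \<Omega> \<A>. expectation_given pr X B * indicator B \<omega>)
      = (\<Sum>B\<in>{A}. expectation_given pr X B * indicator B \<omega>)"
  proof (rule sum.mono_neutral_right)
    show "\<forall>B\<in>atoms \<Omega> \<A> - {A}. expectation_given pr X B * indicator B \<omega> = 0"
      using atoms_eqI[OF _ A(1) _ A(2)] by (metis DiffE indicator_simps(2) insertI1 mult_zero_right)
  qed (use A finite_atoms[OF assms(1)] in auto)
  then show ?thesis
    using A atoms_memD(1)[OF A(1)] by (auto simp: cond_expectation_def)
qed

section \<open>Averaging over atoms: linearity, the tower property and total expectation\<close>

context prob_scheme
begin

lemma event_prob_atom_pos: "A \<in> atoms \<Omega> \<A> \<Longrightarrow> 0 < event_prob pr A"
  by (rule prob_scheme.pr_pos[OF prob_scheme_atoms[OF prob_scheme_axioms]])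

text \<open>The hypothesis concerns points of \<open>A\<close> alone, so that an element of
  \<open>\<A>\<close>, being constant on the atom, can serve as the scalar \<open>c\<close>.\<close>

lemma expectation_given_mult:
  assumes "\<And>\<omega>. \<omega> \<in> A \<Longrightarrow> Z \<omega> = c * X \<omega>"
  shows "expectation_given pr Z A = c * expectation_given pr X A"
proof -
  have "(\<Sum>\<omega>\<in>A. Z \<omega> * pr \<omega>) = c * (\<Sum>\<omega>\<in>A. X \<omega> * pr \<omega>)"
    using assms by (simp add: sum_distrib_left mult.assoc)
  then show ?thesis
    by (simp add: expectation_given_def)
qed

lemma expectation_given_add:
  assumes "\<And>\<omega>. \<omega> \<in> A \<Longrightarrow> Z \<omega> = X \<omega> + X' \<omega>"
  shows "expectation_given pr Z A = expectation_given pr X A + expectation_given pr X' A"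
proof -
  have "(\<Sum>\<omega>\<in>A. Z \<omega> * pr \<omega>) = (\<Sum>\<omega>\<in>A. X \<omega> * pr \<omega>) + (\<Sum>\<omega>\<in>A. X' \<omega> * pr \<omega>)"
    using assms by (simp add: sum.distrib distrib_right)
  then show ?thesis
    by (simp add: expectation_given_def ring_distribs)
qed

lemma cond_expectation_add:
  "cond_expectation \<Omega> pr \<A> (\<lambda>\<omega>\<in>\<Omega>. X \<omega> + X' \<omega>)
    = (\<lambda>\<omega>\<in>\<Omega>. cond_expectation \<Omega> pr \<A> X \<omega> + cond_expectation \<Omega> pr \<A> X' \<omega>)"
proof (rule extensionalityI[where A = \<Omega>])
  fix \<omega> assume \<omega>: "\<omega> \<in> \<Omega>"
  then obtain A where A: "A \<in> atoms \<Omega> \<A>" "\<omega> \<in> A"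
    by (rule atom_containing)
  have "expectation_given pr (\<lambda>\<omega>\<in>\<Omega>. X \<omega> + X' \<omega>) A
      = expectation_given pr X A + expectation_given pr X' A"
    using atoms_memD(1)[OF A(1)] by (intro expectation_given_add) auto
  then show "cond_expectation \<Omega> pr \<A> (\<lambda>\<omega>\<in>\<Omega>. X \<omega> + X' \<omega>) \<omega>
      = (\<lambda>\<omega>\<in>\<Omega>. cond_expectation \<Omega> pr \<A> X \<omega> + cond_expectation \<Omega> pr \<A> X' \<omega>) \<omega>"
    using \<omega> by (simp add: cond_expectation_on_atom[OF finite_points A])
qed (simp_all add: cond_expectation_def)

lemma cond_expectation_mult:
  assumes Y: "Y \<in> \<A>"
  shows "cond_expectation \<Omega> pr \<A> (\<lambda>\<omega>\<in>\<Omega>. Y \<omega> * X \<omega>)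
    = (\<lambda>\<omega>\<in>\<Omega>. Y \<omega> * cond_expectation \<Omega> pr \<A> X \<omega>)"
proof (rule extensionalityI[where A = \<Omega>])
  fix \<omega> assume \<omega>: "\<omega> \<in> \<Omega>"
  then obtain A where A: "A \<in> atoms \<Omega> \<A>" "\<omega> \<in> A"
    by (rule atom_containing)
  \<comment> \<open>On \<open>A\<close> the function \<open>Y\<close> has the constant value
    \<open>Y \<omega>\<close>, which comes out of the average.\<close>
  have "expectation_given pr (\<lambda>\<omega>\<in>\<Omega>. Y \<omega> * X \<omega>) A = Y \<omega> * expectation_given pr X A"
    using atoms_memD(1)[OF A(1)] constant_on_atom[OF Y A(1) _ A(2)]
    by (intro expectation_given_mult) auto
  then show "cond_expectation \<Omega> pr \<A> (\<lambda>\<omega>\<in>\<Omega>. Y \<omega> * X \<omega>) \<omega>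
      = (\<lambda>\<omega>\<in>\<Omega>. Y \<omega> * cond_expectation \<Omega> pr \<A> X \<omega>) \<omega>"
    using \<omega> by (simp add: cond_expectation_on_atom[OF finite_points A])
qed (simp_all add: cond_expectation_def)

lemma linear_over_cond_expectation: "linear_over \<Omega> \<A> (cond_expectation \<Omega> pr \<A>)"
  unfolding linear_over_def
  by (auto simp: cond_expectation_add cond_expectation_mult)
     (auto simp: cond_expectation_def real_functions_def)

lemma cond_expectation_id:
  assumes "unital_subalgebra \<Omega> \<A>" "Y \<in> \<A>"
  shows "cond_expectation \<Omega> pr \<A> Y = Y"
proof (rule extensionalityI[where A = \<Omega>])
  fix \<omega> assume "\<omega> \<in> \<Omega>"
  then obtain A where A: "A \<in> atoms \<Omega> \<A>" "\<omega> \<in> A"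
    by (rule atom_containing)
  \<comment> \<open>On \<open>A\<close>, \<open>Y\<close> is \<open>Y \<omega>\<close> times the
    constant 1, whose average is 1.\<close>
  have "expectation_given pr Y A = Y \<omega> * expectation_given pr (\<lambda>_. 1) A"
    using constant_on_atom[OF assms(2) A(1) _ A(2)] by (intro expectation_given_mult) auto
  also have "expectation_given pr (\<lambda>_. 1) A = 1"
    using event_prob_atom_pos[OF A(1)] by (simp add: expectation_given_def event_prob_def)
  finally show "cond_expectation \<Omega> pr \<A> Y \<omega> = Y \<omega>"
    by (simp add: cond_expectation_on_atom[OF finite_points A])
qed (use assms unital_subalgebraD(5) in \<open>auto simp: cond_expectation_def\<close>)

text \<open>The average is constant on the atom, so summing it with weights multiplies it by
  \<open>event_prob pr A\<close>, which cancels the nonzero denominator.\<close>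

lemma sum_atom_cond_expectation:
  assumes A: "A \<in> atoms \<Omega> \<A>"
  shows "(\<Sum>\<omega>\<in>A. cond_expectation \<Omega> pr \<A> X \<omega> * pr \<omega>) = (\<Sum>\<omega>\<in>A. X \<omega> * pr \<omega>)"
proof -
  have "(\<Sum>\<omega>\<in>A. cond_expectation \<Omega> pr \<A> X \<omega> * pr \<omega>) = expectation_given pr X A * event_prob pr A"
    by (simp add: cond_expectation_on_atom[OF finite_points A] event_prob_def sum_distrib_left)
  then show ?thesis
    using event_prob_atom_pos[OF A] by (simp add: expectation_given_def)
qed

lemma expectation_cond_expectation:
  "expectation \<Omega> pr (cond_expectation \<Omega> pr \<A> X) = expectation \<Omega> pr X"
  unfolding expectation_def sum_over_atoms[OF finite_points, of _ \<A>, symmetric]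
  by (simp add: sum_atom_cond_expectation)

text \<open>By \<open>\<A>\<close>-linearity \<open>Z\<close> moves inside the operator, which
  preserves expectation. The bracketing isolates \<open>Z\<close>, ready for an indicator to be put
  in its place.\<close>

lemma expectation_mult_cond_expectation:
  assumes "Z \<in> \<A>"
  shows "(\<Sum>\<omega>\<in>\<Omega>. Z \<omega> * (cond_expectation \<Omega> pr \<A> X \<omega> * pr \<omega>)) = (\<Sum>\<omega>\<in>\<Omega>. Z \<omega> * (X \<omega> * pr \<omega>))"
  using expectation_cond_expectation[of \<A> "\<lambda>\<omega>\<in>\<Omega>. Z \<omega> * X \<omega>"]
  by (simp add: expectation_def cond_expectation_mult[OF assms] mult.assoc)

lemma cond_expectation_tower:
  assumes \<B>: "unital_subalgebra \<Omega> \<B>" and "\<B> \<subseteq> \<A>"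
  shows "cond_expectation \<Omega> pr \<B> (cond_expectation \<Omega> pr \<A> X) = cond_expectation \<Omega> pr \<B> X"
proof -
  have "expectation_given pr (cond_expectation \<Omega> pr \<A> X) B = expectation_given pr X B"
    if B: "B \<in> atoms \<Omega> \<B>" for B
  proof -
    \<comment> \<open>The indicator of an atom of \<open>\<B>\<close> lies in \<open>\<B>\<close>,
      hence in \<open>\<A>\<close>, and is therefore an admissible multiplier.\<close>
    have ind: "(\<lambda>\<omega>\<in>\<Omega>. indicator B \<omega>) \<in> \<A>"
      using indicator_atom_mem[OF finite_points \<B> B] assms(2) by blast
    have restrict: "(\<Sum>\<omega>\<in>\<Omega>. (\<lambda>\<omega>\<in>\<Omega>. indicator B \<omega>) \<omega> * f \<omega>) = (\<Sum>\<omega>\<in>B. f \<omega>)"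
      for f :: "'a \<Rightarrow> real"
    proof -
      have "(\<Sum>\<omega>\<in>\<Omega>. (\<lambda>\<omega>\<in>\<Omega>. indicator B \<omega>) \<omega> * f \<omega>) = (\<Sum>\<omega>\<in>\<Omega> \<inter> B. f \<omega>)"
        by (simp add: sum_indicator_mult finite_points)
      then show ?thesis
        using atoms_memD(1)[OF B] by (simp add: Int_absorb1)
    qed
    show ?thesis
      using expectation_mult_cond_expectation[OF ind, of X]
      unfolding restrict by (simp add: expectation_given_def)
  qed
  \<comment> \<open>Relative to \<open>\<B>\<close> the operator sees its argument only through the
    averages over atoms of \<open>\<B>\<close>, and these agree.\<close>
  then show ?thesis
    by (simp add: cond_expectation_def)
qed

text \<open>The constant value of \<open>Y\<close> on an atom times the probability of that atom is
  the weighted sum of \<open>Y\<close> over it; the atoms partition \<open>\<Omega>\<close>.\<close>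

lemma expectation_on_atoms:
  assumes Y: "Y \<in> \<A>"
  shows "expectation (atoms \<Omega> \<A>) (event_prob pr) (on_atoms \<Omega> \<A> Y) = expectation \<Omega> pr Y"
proof -
  have "on_atoms \<Omega> \<A> Y A * event_prob pr A = (\<Sum>\<omega>\<in>A. Y \<omega> * pr \<omega>)" if "A \<in> atoms \<Omega> \<A>" for A
    using on_atoms_eq[OF Y that] by (simp add: event_prob_def sum_distrib_left)
  then show ?thesis
    by (simp add: expectation_def sum_over_atoms[OF finite_points])
qed

end

theorem proposition6:
  fixes \<Omega> :: "'a set" and pr :: "'a \<Rightarrow> real" and \<A> :: "('a \<Rightarrow> real) set"
  assumes "prob_scheme \<Omega> pr"
    and "unital_subalgebra \<Omega> \<A>"
  shows "(linear_over \<Omega> \<A> (cond_expectation \<Omega> pr \<A>)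
          \<and> (\<forall>X\<in>\<A>. cond_expectation \<Omega> pr \<A> X = X))
    \<and> (\<forall>\<B>. unital_subalgebra \<Omega> \<B> \<and> \<B> \<subseteq> \<A> \<longrightarrow>
          (\<forall>X\<in>real_functions \<Omega>.
             cond_expectation \<Omega> pr \<B> (cond_expectation \<Omega> pr \<A> X) = cond_expectation \<Omega> pr \<B> X))
    \<and> (\<forall>X\<in>real_functions \<Omega>.
          cond_expectation \<Omega> pr \<A> X \<in> \<A>
          \<and> expectation (atoms \<Omega> \<A>) (event_prob pr)
              (on_atoms \<Omega> \<A> (cond_expectation \<Omega> pr \<A> X)) = expectation \<Omega> pr X)"
proof -
  interpret prob_scheme \<Omega> pr by fact
  note alg = assms(2)
  show ?thesis
    using linear_over_cond_expectation cond_expectation_id[OF alg] cond_expectation_tower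
      cond_expectation_mem[OF finite_points alg]
    by (simp add: expectation_on_atoms expectation_cond_expectation)
qed

end
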